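(* Let $C_m^1$ be the capacity with subcarrier collisions of the $m$th secondary user (SU) in the presence of a single ($n$th) primary user (PU), as defined in the context. Tight upper and lower bounds on the average capacity of the SU are given by $$k_{nm}^{\max}\,\mathbb{E}\left[C_{m,i}^{I,n}\right]+k_{fm}^{\min}\,\mathbb{E}\left[C_{m,i}^{NI}\right]\;\le\;\mathbb{E}\left[C_m^1\right]\;\le\;k_{nm}^{\min}\,\mathbb{E}\left[C_{m,i}^{I,n}\right]+k_{fm}^{\max}\,\mathbb{E}\left[C_{m,i}^{NI}\right],$$ where $k_{nm}^{\max}=\min\{F_m^S,F_n^P\}$ and $k_{nm}^{\min}=\max\{0,F_m^S+F_n^P-F\}$ are the maximum and minimum number of subcarrier collisions, $k_{fm}^{\max}=F_m^S-k_{nm}^{\min}$ and $k_{fm}^{\min}=F_m^S-k_{nm}^{\max}$.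
   Context: Model. There are $F$ subcarriers, of which a fixed set of $F_n^P$ are used by the PU. The SU picks a set of $F_m^S$ of the $F$ subcarriers uniformly at random (without replacement). Let $k_{nm}$ be the number of picked subcarriers that are used by the PU (collisions) and $k_{fm}=F_m^S-k_{nm}$ the number of collision-free ones; $k_{nm}$ is hypergeometric. Per-subcarrier quantities: $P_{m,i},P_{n,i},\Psi_i,\eta>0$ are constants not depending on the subcarrier index $i$ (SU peak transmit power, PU transmit power, interference temperature, noise variance). $h_{m,i},h_{mp,i},g_{ns,i}$ are independent positive random variables (channel power gains, arbitrary fading distributions), i.i.d. over $i$. Set $\lambda_{m,i}=h_{m,i}\min\{P_{m,i},\Psi_i/h_{mp,i}\}$, $C_{m,i}^{I,n}=\log\bigl(1+\lambda_{m,i}/(P_{n,i}g_{ns,i}+\eta)\bigr)$ (capacity of the $i$th subcarrier with interference from the PU) and $C_{m,i}^{NI}=\log(1+\lambda_{m,i}/\eta)$ (without interference), with natural logarithm; one has $\mathbb{E}[C_{m,i}^{I,n}]\le\mathbb{E}[C_{m,i}^{NI}]$. The variables $C_{m,i}^{I,n}$ are i.i.d. in $i$, and so are the $C_{m,i}^{NI}$; the random subcarrier choice is independent of the channel gains. The SU capacity with collisions is $$C_m^1=\sum_{i=1}^{k_{nm}}C_{m,i}^{I,n}+\sum_{i=1}^{k_{fm}}C_{m,i}^{NI}.$$ The word "tight" is the source's, without a formal definition; it is used in contrast to the naive bounds $F_m^S\,\mathbb{E}[C_{m,i}^{I,n}]\le\mathbb{E}[C_m^1]\le F_m^S\,\mathbb{E}[C_{m,i}^{NI}]$,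 the refinement being that the number of collisions $k_{nm}$ has support $\{k_{nm}^{\min},\dots,k_{nm}^{\max}\}$ rather than necessarily $\{0,\dots,F_m^S\}$. *)

theory Defs
  imports "HOL-Probability.Probability"
begin

datatype link = SU_to_SU | SU_to_PU | PU_to_SU

text \<open>The three families of channel power gains, merged into one family so that mutual independence
  across both links and subcarriers can be stated by a single \<open>indep_vars\<close>.\<close>

fun gain :: "(nat \<Rightarrow> 'a \<Rightarrow> real) \<Rightarrow> (nat \<Rightarrow> 'a \<Rightarrow> real) \<Rightarrow> (nat \<Rightarrow> 'a \<Rightarrow> real)
    \<Rightarrow> link \<times> nat \<Rightarrow> 'a \<Rightarrow> real" where
  "gain h hmp g (SU_to_SU, i) = h i"
| "gain h hmp g (SU_to_PU, i) = hmp i"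
| "gain h hmp g (PU_to_SU, i) = g i"

definition rx_power :: "real \<Rightarrow> real \<Rightarrow> real \<Rightarrow> real \<Rightarrow> real" where
  "rx_power Pm \<Psi> h hmp = h * min Pm (\<Psi> / hmp)"

definition cap_I :: "real \<Rightarrow> real \<Rightarrow> real \<Rightarrow> real \<Rightarrow> real \<Rightarrow> real \<Rightarrow> real \<Rightarrow> real" where
  "cap_I Pm Pn \<Psi> \<eta> h hmp g = ln (1 + rx_power Pm \<Psi> h hmp / (Pn * g + \<eta>))"

definition cap_NI :: "real \<Rightarrow> real \<Rightarrow> real \<Rightarrow> real \<Rightarrow> real \<Rightarrow> real" where
  "cap_NI Pm \<Psi> \<eta> h hmp = ln (1 + rx_power Pm \<Psi> h hmp / \<eta>)"

definition total_capacity :: "(nat \<Rightarrow> 'a \<Rightarrow> real) \<Rightarrow> (nat \<Rightarrow> 'a \<Rightarrow> real)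
    \<Rightarrow> ('a \<Rightarrow> nat) \<Rightarrow> ('a \<Rightarrow> nat) \<Rightarrow> 'a \<Rightarrow> real" where
  "total_capacity CI CNI knm kfm \<omega> =
     (\<Sum>i = 1..knm \<omega>. CI i \<omega>) + (\<Sum>i = 1..kfm \<omega>. CNI i \<omega>)"

text \<open>Expectation of an almost surely nonnegative random variable, with values in \<open>[0, \<infinity>]\<close>.
  The fading distributions are arbitrary, so the mean capacities need not be finite; the Bochner
  integral would then return the junk value 0.\<close>

definition mean :: "'a measure \<Rightarrow> ('a \<Rightarrow> real) \<Rightarrow> ennreal" where
  "mean M X = (\<integral>\<^sup>+\<omega>. ennreal (X \<omega>) \<partial>M)"

definition knm_max :: "nat \<Rightarrow> nat \<Rightarrow> nat" where
  "knm_max FmS FnP = min FmS FnP"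

definition knm_min :: "nat \<Rightarrow> nat \<Rightarrow> nat \<Rightarrow> nat" where
  "knm_min F FmS FnP = nat (max 0 (int FmS + int FnP - int F))"

definition kfm_max :: "nat \<Rightarrow> nat \<Rightarrow> nat \<Rightarrow> nat" where
  "kfm_max F FmS FnP = FmS - knm_min F FmS FnP"

definition kfm_min :: "nat \<Rightarrow> nat \<Rightarrow> nat" where
  "kfm_min FmS FnP = FmS - knm_max FmS FnP"

definition lower_bound :: "nat \<Rightarrow> nat \<Rightarrow> ennreal \<Rightarrow> ennreal \<Rightarrow> ennreal" where
  "lower_bound FmS FnP EI ENI =
     of_nat (knm_max FmS FnP) * EI + of_nat (kfm_min FmS FnP) * ENI"

definition upper_bound :: "nat \<Rightarrow> nat \<Rightarrow> nat \<Rightarrow> ennreal \<Rightarrow> ennreal \<Rightarrow> ennreal" where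
  "upper_bound F FmS FnP EI ENI =
     of_nat (knm_min F FmS FnP) * EI + of_nat (kfm_max F FmS FnP) * ENI"

end

theory Submission
  imports Defs
begin

text \<open>Independence of the subcarrier choice from the gains means that conditioning on
  \<open>{knm = k}\<close> leaves the joint law of the gains unchanged. Hence the conditional mean
  capacity is \<open>\<mu> k = k EI + (FmS - k) ENI\<close>, which is antitone in \<open>k\<close> because \<open>EI \<le> ENI\<close>;
  the unconditional mean is an average of the \<open>\<mu> k\<close> over the support of \<open>knm\<close>.\<close>

section \<open>Attainable intersection sizes and monotone weights\<close>

lemma ex_subset_card_Int_iff:
  assumes "finite X" "U \<subseteq> X" "n \<le> card X"
  shows "(\<exists>A\<subseteq>X. card A = n \<and> card (A \<inter> U) = k)
    \<longleftrightarrow> k \<in> {knm_min (card X) n (card U)..knm_max n (card U)}"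
proof -
  have fU: "finite U" using assms finite_subset by blast
  have cX: "card X = card U + card (X - U)"
    by (metis assms(1,2) card_Diff_subset card_mono fU le_add_diff_inverse)
  \<comment> \<open>Since \<open>card X = card U + card (X - U)\<close>, the lower endpoint
    expresses that the remaining \<open>n - k\<close> elements fit into
    \<open>X - U\<close>.\<close>
  have bounds: "k \<in> {knm_min (card X) n (card U)..knm_max n (card U)}
    \<longleftrightarrow> k \<le> n \<and> k \<le> card U \<and> n - k \<le> card (X - U)"
    unfolding knm_min_def knm_max_def cX by auto
  show ?thesis
    unfolding bounds
  proof
    assume "\<exists>A\<subseteq>X. card A = n \<and> card (A \<inter> U) = k"
    then obtain A where A: "A \<subseteq> X" "card A = n" "card (A \<inter> U) = k" by blast
    have fA: "finite A" using A assms finite_subset by blast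
    have "card A = card (A \<inter> U) + card (A - U)"
      using fA by (metis Int_Diff_Un Int_Diff_disjoint card_Un_disjoint finite_Diff finite_Int)
    moreover have "card (A - U) \<le> card (X - U)"
      using A assms by (intro card_mono) auto
    moreover have "card (A \<inter> U) \<le> card U" using fU by (intro card_mono) auto
    ultimately show "k \<le> n \<and> k \<le> card U \<and> n - k \<le> card (X - U)" using A by auto
  next
    assume k: "k \<le> n \<and> k \<le> card U \<and> n - k \<le> card (X - U)"
    obtain B where B: "B \<subseteq> U" "card B = k" "finite B"
      using k obtain_subset_with_card_n by blast
    obtain C where C: "C \<subseteq> X - U" "card C = n - k" "finite C"
      using k obtain_subset_with_card_n by blast
    have "card (B \<union> C) = n"
      using B C k by (subst card_Un_disjoint) auto
    moreover have "(B \<union> C) \<inter> U = B" using B C by auto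
    ultimately show "\<exists>A\<subseteq>X. card A = n \<and> card (A \<inter> U) = k"
      using B C assms by (intro exI[of _ "B \<union> C"]) auto
  qed
qed

text \<open>Going from \<open>k\<close> to \<open>k'\<close> moves the weight \<open>k' - k\<close>
  from \<open>b\<close> to the smaller value \<open>a\<close>, while the total weight stays
  \<open>n\<close>.\<close>

lemma convex_weights_antimono:
  fixes a b :: ennreal
  assumes "a \<le> b" "k \<le> k'" "k' \<le> n"
  shows "of_nat k' * a + of_nat (n - k') * b \<le> of_nat k * a + of_nat (n - k) * b"
proof -
  obtain d where d: "k' = k + d" using assms le_Suc_ex by blast
  have n: "n - k = d + (n - k')" using assms d by auto
  have "of_nat d * a \<le> of_nat d * b" using assms by (intro mult_left_mono) auto
  then show ?thesis
    unfolding n d by (simp add: distrib_right add.assoc add_left_mono add_right_mono)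
qed

section \<open>Capacity of a single subcarrier\<close>

lemma borel_measurable_cap_I [measurable]:
  assumes [measurable]: "h \<in> borel_measurable N" "hmp \<in> borel_measurable N" "g \<in> borel_measurable N"
  shows "(\<lambda>x. cap_I Pm Pn \<Psi> \<eta> (h x) (hmp x) (g x)) \<in> borel_measurable N"
  unfolding cap_I_def rx_power_def by measurable

lemma borel_measurable_cap_NI [measurable]:
  assumes [measurable]: "h \<in> borel_measurable N" "hmp \<in> borel_measurable N"
  shows "(\<lambda>x. cap_NI Pm \<Psi> \<eta> (h x) (hmp x)) \<in> borel_measurable N"
  unfolding cap_NI_def rx_power_def by measurable

text \<open>Interference raises the denominator above \<eta> while the received power is positive,
  and \<open>ln\<close> is monotone. This pointwise order yields
  \<open>EI \<le> ENI\<close>.\<close>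

lemma cap_order:
  assumes "Pm > 0" "Pn > 0" "\<Psi> > 0" "\<eta> > 0" "h > 0" "hmp > 0" "g > 0"
  shows "0 \<le> cap_I Pm Pn \<Psi> \<eta> h hmp g"
    and "cap_I Pm Pn \<Psi> \<eta> h hmp g \<le> cap_NI Pm \<Psi> \<eta> h hmp"
proof -
  have pos: "rx_power Pm \<Psi> h hmp > 0" using assms by (simp add: rx_power_def)
  have den: "Pn * g + \<eta> > \<eta>" using assms by simp
  then have "rx_power Pm \<Psi> h hmp / (Pn * g + \<eta>) > 0"
    using pos assms by (intro divide_pos_pos) linarith+
  moreover have "rx_power Pm \<Psi> h hmp / (Pn * g + \<eta>) \<le> rx_power Pm \<Psi> h hmp / \<eta>"
    using pos den assms by (intro divide_left_mono mult_pos_pos) linarith+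
  ultimately show "0 \<le> cap_I Pm Pn \<Psi> \<eta> h hmp g"
    and "cap_I Pm Pn \<Psi> \<eta> h hmp g \<le> cap_NI Pm \<Psi> \<eta> h hmp"
    unfolding cap_I_def cap_NI_def by auto
qed

section \<open>Conditioning, reindexing and joint laws\<close>

lemma mean_distr:
  assumes "V \<in> M \<rightarrow>\<^sub>M N" "f \<in> borel_measurable N"
  shows "mean (distr M N V) f = mean M (\<lambda>\<omega>. f (V \<omega>))"
  using assms by (simp add: mean_def nn_integral_distr)

text \<open>On a preimage \<open>?B\<close> under \<open>V\<close>, independence gives
  \<open>prob (A \<inter> ?B) / prob A = prob ?B\<close>. Independence is stated for families of
  events, so that \<open>A\<close> may come from a variable with values of another type than those
  of \<open>V\<close>.\<close>

lemma (in prob_space) distr_uniform_measure_indep: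
  assumes V: "V \<in> M \<rightarrow>\<^sub>M N" and A: "A \<in> \<A>" "prob A > 0"
    and indep: "indep_set \<A> (sets (vimage_algebra (space M) V N))"
  shows "distr (uniform_measure M A) N V = distr M N V"
proof (rule measure_eqI)
  fix B assume "B \<in> sets (distr (uniform_measure M A) N V)"
  then have B: "B \<in> sets N" by simp
  let ?B = "V -` B \<inter> space M"
  have ev: "A \<in> events" "?B \<in> events"
    using A indep_setD_ev1[OF indep] measurable_sets[OF V B] by auto
  have "prob (A \<inter> ?B) = prob A * prob ?B"
    using indep_setD[OF indep A(1) in_vimage_algebra[OF B]] .
  then have "emeasure (uniform_measure M A) ?B = emeasure M ?B"
    using ev A(2) by (simp add: emeasure_eq_measure divide_ennreal)
  then show "emeasure (distr (uniform_measure M A) N V) B = emeasure (distr M N V) B"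
    using V B by (simp add: emeasure_distr)
qed simp

lemma (in prob_space) indep_sets_reindex:
  assumes inj: "inj_on f I" and indep: "indep_sets \<F> (f ` I)"
  shows "indep_sets (\<lambda>i. \<F> (f i)) I"
proof (rule indep_setsI)
  show "\<F> (f i) \<subseteq> events" if "i \<in> I" for i
    using indep that by (auto simp: indep_sets_def)
next
  fix A J assume J: "J \<noteq> {}" "J \<subseteq> I" "finite J" and A: "\<forall>j\<in>J. A j \<in> \<F> (f j)"
  have injJ: "inj_on f J" using inj J(2) by (rule inj_on_subset)
  have "prob (\<Inter>i\<in>f ` J. A (the_inv_into J f i)) = (\<Prod>i\<in>f ` J. prob (A (the_inv_into J f i)))"
    using J A injJ by (intro indep_setsD[OF indep]) (auto simp: the_inv_into_f_f)
  then show "prob (\<Inter>j\<in>J. A j) = (\<Prod>j\<in>J. prob (A j))"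
    using injJ by (simp add: prod.reindex the_inv_into_f_f cong: INF_cong)
qed

lemma (in prob_space) indep_vars_reindex:
  assumes "inj_on f I" "indep_vars N X (f ` I)"
  shows "indep_vars (\<lambda>i. N (f i)) (\<lambda>i. X (f i)) I"
  using assms indep_sets_reindex[OF assms(1)] unfolding indep_vars_def2 by auto

text \<open>Each column has independent entries, so its joint law is the product of its marginals,
  and these agree. The joint law matters because a capacity depends on several gains of the same
  subcarrier.\<close>

lemma (in prob_space) distr_column_eq:
  fixes X :: "'i \<times> 'j \<Rightarrow> 'a \<Rightarrow> 'b"
  assumes indep: "indep_vars (\<lambda>_. N) X (UNIV \<times> J)" and "j \<in> J" "j' \<in> J"
    and ident: "\<And>l. distr M N (X (l, j)) = distr M N (X (l, j'))"
  shows "distr M (\<Pi>\<^sub>M l\<in>UNIV. N) (\<lambda>\<omega> l. X (l, j) \<omega>)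
    = distr M (\<Pi>\<^sub>M l\<in>UNIV. N) (\<lambda>\<omega> l. X (l, j') \<omega>)"
proof -
  have "distr M (\<Pi>\<^sub>M l\<in>UNIV. N) (\<lambda>\<omega> l. X (l, j) \<omega>) = (\<Pi>\<^sub>M l\<in>UNIV. distr M N (X (l, j)))"
    if "j \<in> J" for j
  proof -
    have iv: "indep_vars (\<lambda>_. N) (\<lambda>l. X (l, j)) UNIV"
      using that by (intro indep_vars_reindex[where f = "\<lambda>l. (l, j)"] indep_vars_subset[OF indep])
        (auto simp: inj_on_def)
    then have "random_variable N (X (l, j))" for l
      by (auto simp: indep_vars_def)
    with iv indep_vars_iff_distr_eq_PiM[where I = UNIV and M' = "\<lambda>_. N" and X = "\<lambda>l. X (l, j)"]
    show ?thesis by (simp add: restrict_def)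
  qed
  then show ?thesis using assms by simp
qed

theorem corollary2:
  fixes M :: "'a measure"
    and F FmS FnP :: nat
    and U :: "nat set"
    and S :: "'a \<Rightarrow> nat set"
    and h hmp g :: "nat \<Rightarrow> 'a \<Rightarrow> real"
    and Pm Pn \<Psi> \<eta> :: real
    and CI CNI :: "nat \<Rightarrow> 'a \<Rightarrow> real"
    and knm kfm :: "'a \<Rightarrow> nat"
    and C1 :: "'a \<Rightarrow> real"
    and EI ENI :: ennreal
    and i :: nat
  assumes "prob_space M"
    and "U \<subseteq> {1..F}" and "card U = FnP" and "FmS \<le> F"
    and "Pm > 0" and "Pn > 0" and "\<Psi> > 0" and "\<eta> > 0"
    and gains_pos: "\<forall>j\<in>{1..F}. AE \<omega> in M. h j \<omega> > 0 \<and> hmp j \<omega> > 0 \<and> g j \<omega> > 0"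
    and gains_indep: "prob_space.indep_vars M (\<lambda>_. borel) (gain h hmp g) (UNIV \<times> {1..F})"
    and gains_ident: "\<forall>l. \<forall>j\<in>{1..F}. \<forall>j'\<in>{1..F}.
      distr M borel (gain h hmp g (l, j)) = distr M borel (gain h hmp g (l, j'))"
    and choice_measurable: "S \<in> M \<rightarrow>\<^sub>M count_space UNIV"
    and choice_uniform: "distr M (count_space UNIV) S =
      measure_pmf (pmf_of_set {A. A \<subseteq> {1..F} \<and> card A = FmS})"
    and choice_indep: "prob_space.indep_set M
      (sets (vimage_algebra (space M) S (count_space UNIV)))
      (sets (vimage_algebra (space M) (\<lambda>\<omega>. \<lambda>p \<in> UNIV \<times> {1..F}. gain h hmp g p \<omega>)
        (\<Pi>\<^sub>M p \<in> UNIV \<times> {1..F}. borel)))"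
    and CI_eq: "CI = (\<lambda>j \<omega>. cap_I Pm Pn \<Psi> \<eta> (h j \<omega>) (hmp j \<omega>) (g j \<omega>))"
    and CNI_eq: "CNI = (\<lambda>j \<omega>. cap_NI Pm \<Psi> \<eta> (h j \<omega>) (hmp j \<omega>))"
    and knm_eq: "knm = (\<lambda>\<omega>. card (S \<omega> \<inter> U))"
    and kfm_eq: "kfm = (\<lambda>\<omega>. FmS - knm \<omega>)"
    and C1_eq: "C1 = total_capacity CI CNI knm kfm"
    and "i \<in> {1..F}"
    and EI_eq: "EI = mean M (CI i)" and ENI_eq: "ENI = mean M (CNI i)"
  shows
    \<comment> \<open>the bounds\<close>
    "lower_bound FmS FnP EI ENI \<le> mean M C1 \<and> mean M C1 \<le> upper_bound F FmS FnP EI ENI \<and>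
    \<comment> \<open>tightness: the coefficients are the extreme points of the support of the collision count,\<close>
    {k. measure M {\<omega> \<in> space M. knm \<omega> = k} > 0} = {knm_min F FmS FnP..knm_max FmS FnP} \<and>
    \<comment> \<open>the bounds refine the naive ones,\<close>
    of_nat FmS * EI \<le> lower_bound FmS FnP EI ENI \<and>
    upper_bound F FmS FnP EI ENI \<le> of_nat FmS * ENI \<and>
    \<comment> \<open>and they are attained by the mean capacity given the extreme numbers of collisions\<close>
    mean (uniform_measure M {\<omega> \<in> space M. knm \<omega> = knm_max FmS FnP}) C1
      = lower_bound FmS FnP EI ENI \<and>
    mean (uniform_measure M {\<omega> \<in> space M. knm \<omega> = knm_min F FmS FnP}) C1
      = upper_bound F FmS FnP EI ENI"
proof -
  interpret prob_space M by fact
  define I where "I = (UNIV :: link set) \<times> {1..F}"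
  define G where "G = (\<Pi>\<^sub>M p\<in>I. (borel :: real measure))"
  \<comment> \<open>All gains form one random element, matching the joint independence in
    \<open>choice_indep\<close>.\<close>
  define V where "V = (\<lambda>\<omega>. \<lambda>p\<in>I. gain h hmp g p \<omega>)"
  define E where "E k = {\<omega> \<in> space M. knm \<omega> = k}" for k
  define K where "K = {knm_min F FmS FnP..knm_max FmS FnP}"
  define Q where "Q = {A. A \<subseteq> {1..F} \<and> card A = FmS}"
  define \<mu> where "\<mu> k = of_nat k * EI + of_nat (FmS - k) * ENI" for k

  \<comment> \<open>Measurability and order of the capacities\<close>
  have gain_meas [measurable]: "gain h hmp g p \<in> borel_measurable M" if "p \<in> I" for p
    using gains_indep that unfolding indep_vars_def I_def by auto
  then have link_meas [measurable]:
    "h j \<in> borel_measurable M" "hmp j \<in> borel_measurable M" "g j \<in> borel_measurable M"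
    if "j \<in> {1..F}" for j
    using that gain_meas[of "(SU_to_SU, j)"] gain_meas[of "(SU_to_PU, j)"]
      gain_meas[of "(PU_to_SU, j)"] by (auto simp: I_def)
  have C_meas: "CI j \<in> borel_measurable M" "CNI j \<in> borel_measurable M" if "j \<in> {1..F}" for j
    using link_meas[OF that] unfolding CI_eq CNI_eq by measurable
  have V_meas: "V \<in> M \<rightarrow>\<^sub>M G"
    unfolding V_def G_def by measurable
  \<comment> \<open>There are finitely many subcarriers, so one null set serves all of them; the
    sums can then be handled pointwise.\<close>
  have C_order: "AE \<omega> in M. \<forall>j\<in>{1..F}. 0 \<le> CI j \<omega> \<and> CI j \<omega> \<le> CNI j \<omega>"
  proof (rule AE_finite_allI)
    fix j assume "j \<in> {1..F}"
    with gains_pos have "AE \<omega> in M. h j \<omega> > 0 \<and> hmp j \<omega> > 0 \<and> g j \<omega> > 0" by blast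
    then show "AE \<omega> in M. 0 \<le> CI j \<omega> \<and> CI j \<omega> \<le> CNI j \<omega>"
      unfolding CI_eq CNI_eq by (rule eventually_mono) (simp add: cap_order assms(5-8))
  qed simp
  have mean_le: "EI \<le> ENI"
    unfolding EI_eq ENI_eq mean_def using C_order \<open>i \<in> {1..F}\<close>
    by (intro nn_integral_mono_AE) (auto elim!: eventually_mono intro: ennreal_leI)

  \<comment> \<open>Mean capacities are the same on all subcarriers\<close>
  have column: "distr M (\<Pi>\<^sub>M l\<in>UNIV. borel) (\<lambda>\<omega> l. gain h hmp g (l, j) \<omega>)
      = distr M (\<Pi>\<^sub>M l\<in>UNIV. borel) (\<lambda>\<omega> l. gain h hmp g (l, i) \<omega>)" if "j \<in> {1..F}" for j
  proof (rule distr_column_eq[OF gains_indep that \<open>i \<in> {1..F}\<close>])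
    show "distr M borel (gain h hmp g (l, j)) = distr M borel (gain h hmp g (l, i))" for l
      using gains_ident that \<open>i \<in> {1..F}\<close> by blast
  qed
  have column_meas: "(\<lambda>\<omega> l. gain h hmp g (l, j) \<omega>) \<in> M \<rightarrow>\<^sub>M (\<Pi>\<^sub>M l\<in>UNIV. borel)"
    if "j \<in> {1..F}" for j
    using that by (intro measurable_PiM_single') (auto simp: I_def)
  have same_mean: "mean M (\<lambda>\<omega>. f (\<lambda>l. gain h hmp g (l, j) \<omega>))
      = mean M (\<lambda>\<omega>. f (\<lambda>l. gain h hmp g (l, i) \<omega>))"
    if "j \<in> {1..F}" "f \<in> borel_measurable (\<Pi>\<^sub>M l\<in>UNIV. borel)" for j f
    using mean_distr[OF column_meas that(2)] column[OF that(1)] that(1) \<open>i \<in> {1..F}\<close> by metis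
  have mean_CI: "mean M (CI j) = EI" if "j \<in> {1..F}" for j
    using same_mean[OF that, of "\<lambda>x. cap_I Pm Pn \<Psi> \<eta> (x SU_to_SU) (x SU_to_PU) (x PU_to_SU)"]
    by (simp add: EI_eq CI_eq)
  have mean_CNI: "mean M (CNI j) = ENI" if "j \<in> {1..F}" for j
    using same_mean[OF that, of "\<lambda>x. cap_NI Pm \<Psi> \<eta> (x SU_to_SU) (x SU_to_PU)"]
    by (simp add: ENI_eq CNI_eq)

  \<comment> \<open>Support of the number of collisions\<close>
  have E_vimage: "E k = S -` {A. card (A \<inter> U) = k} \<inter> space M" for k
    by (auto simp: E_def knm_eq)
  have E_meas [measurable]: "E k \<in> events" for k
    unfolding E_vimage using choice_measurable by (rule measurable_sets) simp
  \<comment> \<open>\<open>pmf_of_set\<close> is the uniform law only on a finite nonempty set;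
    nonemptiness comes from \<open>FmS \<le> F\<close>.\<close>
  have Q: "finite Q" "Q \<noteq> {}"
  proof -
    show "finite Q" unfolding Q_def by simp
    show "Q \<noteq> {}" unfolding Q_def
      using obtain_subset_with_card_n[of FmS "{1..F}"] \<open>FmS \<le> F\<close> by auto
  qed
  have K_iff: "k \<in> K \<longleftrightarrow> (\<exists>A\<in>Q. card (A \<inter> U) = k)" for k
    using ex_subset_card_Int_iff[of "{1..F}" U FmS k] assms(2-4) by (auto simp: K_def Q_def)
  have prob_E: "prob (E k) = measure_pmf.prob (pmf_of_set Q) {A. card (A \<inter> U) = k}" for k
    using choice_uniform measure_distr[OF choice_measurable, of "{A. card (A \<inter> U) = k}"]
    by (simp add: E_vimage Q_def)
  \<comment> \<open>Every member of \<open>Q\<close> has positive mass, so an event about the choice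
    has positive probability exactly when it contains a member of \<open>Q\<close>.\<close>
  have supp: "prob (E k) > 0 \<longleftrightarrow> k \<in> K" for k
    using Q measure_pmf_zero_iff[of "pmf_of_set Q" "{A. card (A \<inter> U) = k}"]
    by (auto simp: prob_E K_iff zero_less_measure_iff set_pmf_of_set)
  have AE_K: "AE \<omega> in M. knm \<omega> \<in> K"
  proof -
    have "AE A in distr M (count_space UNIV) S. A \<in> Q"
      using Q unfolding choice_uniform Q_def[symmetric] by (simp add: AE_measure_pmf_iff)
    then have "AE \<omega> in M. S \<omega> \<in> Q"
      by (subst (asm) AE_distr_iff[OF choice_measurable]) auto
    then show ?thesis by eventually_elim (auto simp: knm_eq K_iff)
  qed
  \<comment> \<open>Together with \<open>FmS \<le> F\<close> this keeps the indices
    \<open>1..k\<close> inside \<open>{1..F}\<close>, where the gains are controlled.\<close>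
  have K_le: "k \<le> FmS" if "k \<in> K" for k
    using that by (auto simp: K_def knm_max_def)

  \<comment> \<open>Conditional means given the number of collisions\<close>
  have cond_distr: "distr (uniform_measure M (E k)) G V = distr M G V" if "k \<in> K" for k
  proof (rule distr_uniform_measure_indep[OF V_meas])
    show "E k \<in> sets (vimage_algebra (space M) S (count_space UNIV))"
      unfolding E_vimage by (rule in_vimage_algebra) simp
    show "prob (E k) > 0" using that supp by simp
    show "indep_set (sets (vimage_algebra (space M) S (count_space UNIV)))
      (sets (vimage_algebra (space M) V G))"
      using choice_indep unfolding V_def G_def I_def .
  qed
  have cond_mean: "mean (uniform_measure M (E k)) (\<lambda>\<omega>. f (V \<omega>)) = mean M (\<lambda>\<omega>. f (V \<omega>))"
    if "k \<in> K" "f \<in> borel_measurable G" for k f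
    using mean_distr[of V "uniform_measure M (E k)" G f] mean_distr[OF V_meas that(2)]
      cond_distr[OF that(1)] V_meas that(2) by simp
  have V_apply: "V \<omega> (l, j) = gain h hmp g (l, j) \<omega>" if "j \<in> {1..F}" for \<omega> l j
    using that by (simp add: V_def I_def)
  have coord: "(\<lambda>v. v (l, j)) \<in> borel_measurable G" if "j \<in> {1..F}" for l j
    using that unfolding G_def I_def by (intro measurable_component_singleton) auto
  have cond_CI: "mean (uniform_measure M (E k)) (CI j) = EI" if "k \<in> K" "j \<in> {1..F}" for k j
    using cond_mean[OF that(1) borel_measurable_cap_I[OF coord[OF that(2), of SU_to_SU]
        coord[OF that(2), of SU_to_PU] coord[OF that(2), of PU_to_SU], of Pm Pn \<Psi> \<eta>]]
      mean_CI[OF that(2)] by (simp add: V_apply[OF that(2)] CI_eq)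
  have cond_CNI: "mean (uniform_measure M (E k)) (CNI j) = ENI" if "k \<in> K" "j \<in> {1..F}" for k j
    using cond_mean[OF that(1) borel_measurable_cap_NI[OF coord[OF that(2), of SU_to_SU]
        coord[OF that(2), of SU_to_PU], of Pm \<Psi> \<eta>]]
      mean_CNI[OF that(2)] by (simp add: V_apply[OF that(2)] CNI_eq)

  \<comment> \<open>Freezing the count at \<open>k\<close> makes the index ranges deterministic, so
    the expectation passes through the sums; with values in \<open>ennreal\<close> this holds for
    infinite means as well.\<close>
  define D where
    "D k \<omega> = (\<Sum>j=1..k. ennreal (CI j \<omega>)) + (\<Sum>j=1..FmS - k. ennreal (CNI j \<omega>))"
    for k \<omega>
  have D_meas [measurable]: "D k \<in> borel_measurable M" if "k \<in> K" for k
    unfolding D_def using C_meas K_le[OF that] \<open>FmS \<le> F\<close>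
    by (intro borel_measurable_add borel_measurable_sum
        measurable_compose[OF _ measurable_ennreal]) auto
  \<comment> \<open>Splitting \<open>ennreal\<close> of a sum into a sum of \<open>ennreal\<close>
    values uses nonnegative summands, which are available only almost everywhere.\<close>
  have C1_D: "AE \<omega> in M. \<forall>k\<in>K. \<omega> \<in> E k \<longrightarrow> ennreal (C1 \<omega>) = D k \<omega>"
    using C_order
  proof eventually_elim
    case (elim \<omega>)
    have nonneg: "0 \<le> CI j \<omega>" "0 \<le> CNI j \<omega>" if "j \<in> {1..F}" for j
      using elim[rule_format, OF that] by auto
    show ?case
    proof (intro ballI impI)
      fix k assume k: "k \<in> K" "\<omega> \<in> E k"
      have "C1 \<omega> = (\<Sum>j=1..k. CI j \<omega>) + (\<Sum>j=1..FmS - k. CNI j \<omega>)"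
        using k by (simp add: C1_eq total_capacity_def kfm_eq E_def)
      also have "ennreal \<dots> = D k \<omega>"
        unfolding D_def using K_le[OF k(1)] \<open>FmS \<le> F\<close>
        by (subst ennreal_plus) (auto intro!: sum_nonneg nonneg arg_cong2[where f = "(+)"] sum_ennreal[symmetric])
      finally show "ennreal (C1 \<omega>) = D k \<omega>" .
    qed
  qed
  have cond_D: "(\<integral>\<^sup>+\<omega>. D k \<omega> \<partial>uniform_measure M (E k)) = \<mu> k" if "k \<in> K" for k
  proof -
    have idx: "j \<in> {1..F}" if "j \<in> {1..k} \<or> j \<in> {1..FmS - k}" for j
      using that K_le[OF \<open>k \<in> K\<close>] \<open>FmS \<le> F\<close> by auto
    have m: "(\<lambda>\<omega>. ennreal (CI j \<omega>)) \<in> borel_measurable M"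
      "(\<lambda>\<omega>. ennreal (CNI j \<omega>)) \<in> borel_measurable M" if "j \<in> {1..F}" for j
      using C_meas[OF that] by auto
    have "(\<integral>\<^sup>+\<omega>. D k \<omega> \<partial>uniform_measure M (E k))
      = (\<Sum>j=1..k. mean (uniform_measure M (E k)) (CI j))
        + (\<Sum>j=1..FmS - k. mean (uniform_measure M (E k)) (CNI j))"
      unfolding D_def mean_def using m[OF idx]
      by (subst nn_integral_add)
        (auto intro!: borel_measurable_sum arg_cong2[where f = "(+)"] nn_integral_sum)
    also have "\<dots> = \<mu> k"
      using idx by (simp add: cond_CI[OF that] cond_CNI[OF that] \<mu>_def)
    finally show ?thesis .
  qed
  \<comment> \<open>The conditional measure gives no mass to the complement of \<open>E k\<close>,
    so agreement of \<open>C1\<close> with \<open>D k\<close> almost everywhere on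
    \<open>E k\<close> suffices.\<close>
  have cond_C1: "mean (uniform_measure M (E k)) C1 = \<mu> k" if "k \<in> K" for k
    unfolding mean_def cond_D[OF that, symmetric] using that
    by (intro nn_integral_cong_AE AE_uniform_measureI E_meas eventually_mono[OF C1_D]) auto

  \<comment> \<open>Law of total expectation\<close>
  have sum_indicator_E: "(\<Sum>k\<in>K. f k * indicator (E k) \<omega>) = f (knm \<omega>)"
    if "knm \<omega> \<in> K" "\<omega> \<in> space M" for f :: "nat \<Rightarrow> ennreal" and \<omega>
  proof -
    have "(\<Sum>k\<in>K. f k * indicator (E k) \<omega>) = (\<Sum>k\<in>K. if k = knm \<omega> then f k else 0)"
      using that by (intro sum.cong) (auto simp: E_def)
    then show ?thesis using that by (simp add: K_def)
  qed
  have "mean M C1 = (\<integral>\<^sup>+\<omega>. (\<Sum>k\<in>K. D k \<omega> * indicator (E k) \<omega>) \<partial>M)"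
    unfolding mean_def
  proof (rule nn_integral_cong_AE)
    show "AE \<omega> in M. ennreal (C1 \<omega>) = (\<Sum>k\<in>K. D k \<omega> * indicator (E k) \<omega>)"
      using C1_D AE_K AE_space by eventually_elim (subst sum_indicator_E, auto simp: E_def)
  qed
  also have "\<dots> = (\<Sum>k\<in>K. \<integral>\<^sup>+\<omega>. D k \<omega> * indicator (E k) \<omega> \<partial>M)"
    by (intro nn_integral_sum borel_measurable_times_ennreal D_meas borel_measurable_indicator E_meas)
  also have "\<dots> = (\<Sum>k\<in>K. emeasure M (E k) * \<mu> k)"
  proof (intro sum.cong refl)
    fix k assume k: "k \<in> K"
    \<comment> \<open>The conditional integral carries a division by
      \<open>emeasure M (E k)\<close>; multiplying back in \<open>ennreal\<close> is legitimate
      because this number is nonzero and finite.\<close>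
    then have "emeasure M (E k) \<noteq> 0" using supp[of k] by (simp add: emeasure_eq_measure)
    then show "(\<integral>\<^sup>+\<omega>. D k \<omega> * indicator (E k) \<omega> \<partial>M) = emeasure M (E k) * \<mu> k"
      using cond_D[OF k] nn_integral_uniform_measure[OF D_meas[OF k] E_meas[of k]]
      by (metis ennreal_divide_self ennreal_divide_times emeasure_finite infinity_ennreal_def
          less_top mult.commute mult.right_neutral)
  qed
  finally have mean_C1: "mean M C1 = (\<Sum>k\<in>K. emeasure M (E k) * \<mu> k)" .
  \<comment> \<open>The same decomposition, applied to the constant 1, shows that the weights of the
    average sum to 1.\<close>
  have "1 = (\<integral>\<^sup>+\<omega>. (\<Sum>k\<in>K. 1 * indicator (E k) \<omega>) \<partial>M)"
  proof -
    have "1 = (\<integral>\<^sup>+\<omega>. 1 \<partial>M)" by (simp add: emeasure_space_1)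
    also have "\<dots> = (\<integral>\<^sup>+\<omega>. (\<Sum>k\<in>K. 1 * indicator (E k) \<omega>) \<partial>M)"
      using AE_K AE_space
      by (intro nn_integral_cong_AE, eventually_elim) (simp only: sum_indicator_E)
    finally show ?thesis .
  qed
  also have "\<dots> = (\<Sum>k\<in>K. emeasure M (E k))"
    by (simp add: nn_integral_sum)
  finally have weights: "(\<Sum>k\<in>K. emeasure M (E k)) = 1" by simp

  \<comment> \<open>Bounds, attainment and comparison with the naive bounds\<close>
  have \<mu>_antimono: "\<mu> k' \<le> \<mu> k" if "k \<le> k'" "k' \<le> FmS" for k k'
    unfolding \<mu>_def by (rule convex_weights_antimono[OF mean_le that])
  \<comment> \<open>An admissible choice exists, so the interval \<open>K\<close> is nonempty and
    contains both its endpoints.\<close>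
  have "K \<noteq> {}" using Q K_iff by blast
  then have ends: "knm_max FmS FnP \<in> K" "knm_min F FmS FnP \<in> K" by (auto simp: K_def)
  have lower: "lower_bound FmS FnP EI ENI = \<mu> (knm_max FmS FnP)"
    by (simp add: lower_bound_def \<mu>_def kfm_min_def)
  have upper: "upper_bound F FmS FnP EI ENI = \<mu> (knm_min F FmS FnP)"
    by (simp add: upper_bound_def \<mu>_def kfm_max_def)
  \<comment> \<open>The extreme value is written as an average with the same weights as
    \<open>mean M C1\<close>, so that the two compare term by term.\<close>
  have "\<mu> (knm_max FmS FnP) = (\<Sum>k\<in>K. emeasure M (E k) * \<mu> (knm_max FmS FnP))"
    by (simp add: weights flip: sum_distrib_right)
  also have "\<dots> \<le> mean M C1"
    unfolding mean_C1 by (intro sum_mono mult_left_mono \<mu>_antimono) (auto simp: K_def knm_max_def)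
  finally have lower_le: "lower_bound FmS FnP EI ENI \<le> mean M C1" unfolding lower .
  have "mean M C1 \<le> (\<Sum>k\<in>K. emeasure M (E k) * \<mu> (knm_min F FmS FnP))"
    unfolding mean_C1 by (intro sum_mono mult_left_mono \<mu>_antimono K_le) (auto simp: K_def)
  also have "\<dots> = \<mu> (knm_min F FmS FnP)"
    by (simp add: weights flip: sum_distrib_right)
  finally have le_upper: "mean M C1 \<le> upper_bound F FmS FnP EI ENI" unfolding upper .
  \<comment> \<open>The naive bounds are \<open>\<mu> FmS\<close> and \<open>\<mu> 0\<close>, whose
    arguments may lie outside \<open>K\<close>; hence antitonicity is used on all of
    \<open>{0..FmS}\<close>.\<close>
  have "of_nat FmS * EI \<le> lower_bound FmS FnP EI ENI"
    "upper_bound F FmS FnP EI ENI \<le> of_nat FmS * ENI"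
    using \<mu>_antimono[of "knm_max FmS FnP" FmS] \<mu>_antimono[of 0 "knm_min F FmS FnP"] K_le ends
    unfolding lower upper by (auto simp: \<mu>_def)
  moreover have "{k. prob (E k) > 0} = {knm_min F FmS FnP..knm_max FmS FnP}"
    unfolding supp K_def by (rule Collect_mem_eq)
  ultimately show ?thesis
    using lower_le le_upper cond_C1[OF ends(1)] cond_C1[OF ends(2)]
    unfolding lower upper E_def by (intro conjI)
qed

end
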